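(* Let $G$ be an infinite, connected, vertex-transitive, $d$-regular directed graph (with symmetric edge set). Suppose $\chi(G,{\bf p})<\infty$. Then there exists $\alpha(G,{\bf p})>0$ such that $$P_{\bf p}(o\leftrightharpoons\partial B(n))\le 2e^{-n\alpha(G,{\bf p})}$$ for any sufficiently large $n$.
   Context: $G=(V,E,o)$ is an infinite simple directed graph with origin $o\in V$: $V$ is countably infinite, $E\subset V\times V\setminus\{(x,x)\}$, and $(x,y)\in E$ iff $(y,x)\in E$; $x\sim y$ means $(x,y)\in E$; $L_x=\{y:(x,y)\in E\}$. $G$ is $d$-regular ($|L_x|=d$ for all $x$), connected with respect to $\sim$, and vertex-transitive (automorphisms act transitively on $V$). $\partial B(n)$ is the set of vertices at graph distance exactly $n$ from $o$. Let ${\bf p}=(p_0,\dots,p_d)$ with $p_i\ge0$ and $\sum_i p_i=1$. Configurations are $\omega\in\Omega=\prod_{x\in V}2^{L_x}$ with the $\sigma$-field generated by finite-dimensional cylinders; $P_{\bf p}$ is the product measure under which the states $\omega(x)\subset L_x$ are independent with $P_{\bf p}(\omega(x)=S)=p_{|S|}/\binom{d}{|S|}$ for $S\subset L_x$. Put $E_\omega=\{(x,y):x\in V,\ y\in\omega(x)\}$. Vertices $x,y$ are weakly connected ($x\leftrightharpoons y$) if $x=y$ or there are $x=z_0,\dots,z_m=y$ such that for each $i$, $(z_i,z_{i+1})\in E_\omega$ or $(z_{i+1},z_i)\in E_\omega$; $o\leftrightharpoons\partial B(n)$ means $o\leftrightharpoons x$ for some $x\in\partial B(n)$. $|C|$ is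 the number of vertices weakly connected to $o$, and $\chi(G,{\bf p})=\mathbb{E}_{\bf p}(|C|)$. *)

theory Defs
  imports "HOL-Probability.Probability"
begin

definition simple_symmetric_digraph :: "'a set \<Rightarrow> ('a \<times> 'a) set \<Rightarrow> bool" where
  "simple_symmetric_digraph V E \<longleftrightarrow>
     infinite V \<and> countable V \<and> E \<subseteq> V \<times> V \<and> irrefl E \<and> sym E"

definition nbrs :: "('a \<times> 'a) set \<Rightarrow> 'a \<Rightarrow> 'a set" where
  "nbrs E x = {y. (x, y) \<in> E}"

(* Finiteness is stated separately because card of an infinite set is 0. *)
definition regular_digraph :: "'a set \<Rightarrow> ('a \<times> 'a) set \<Rightarrow> nat \<Rightarrow> bool" where
  "regular_digraph V E d \<longleftrightarrow> (\<forall>x\<in>V. finite (nbrs E x) \<and> card (nbrs E x) = d)"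

definition connected_digraph :: "'a set \<Rightarrow> ('a \<times> 'a) set \<Rightarrow> bool" where
  "connected_digraph V E \<longleftrightarrow> (\<forall>x\<in>V. \<forall>y\<in>V. (x, y) \<in> E\<^sup>*)"

definition digraph_automorphism :: "'a set \<Rightarrow> ('a \<times> 'a) set \<Rightarrow> ('a \<Rightarrow> 'a) \<Rightarrow> bool" where
  "digraph_automorphism V E \<phi> \<longleftrightarrow>
     bij_betw \<phi> V V \<and> (\<forall>x\<in>V. \<forall>y\<in>V. (x, y) \<in> E \<longleftrightarrow> (\<phi> x, \<phi> y) \<in> E)"

definition vertex_transitive :: "'a set \<Rightarrow> ('a \<times> 'a) set \<Rightarrow> bool" where
  "vertex_transitive V E \<longleftrightarrow>
     (\<forall>x\<in>V. \<forall>y\<in>V. \<exists>\<phi>. digraph_automorphism V E \<phi> \<and> \<phi> x = y)"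

(* Meaningful only when y is reachable from x. *)
definition graph_dist :: "('a \<times> 'a) set \<Rightarrow> 'a \<Rightarrow> 'a \<Rightarrow> nat" where
  "graph_dist E x y = (LEAST n. (x, y) \<in> E ^^ n)"

definition graph_sphere :: "'a set \<Rightarrow> ('a \<times> 'a) set \<Rightarrow> 'a \<Rightarrow> nat \<Rightarrow> 'a set" where
  "graph_sphere V E orig n = {x \<in> V. graph_dist E orig x = n}"

definition prob_vector :: "nat \<Rightarrow> (nat \<Rightarrow> real) \<Rightarrow> bool" where
  "prob_vector d p \<longleftrightarrow> (\<forall>i\<le>d. 0 \<le> p i) \<and> (\<Sum>i\<le>d. p i) = 1"

definition vertex_law :: "('a \<times> 'a) set \<Rightarrow> nat \<Rightarrow> (nat \<Rightarrow> real) \<Rightarrow> 'a \<Rightarrow> 'a set measure" where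
  "vertex_law E d p x =
     point_measure (Pow (nbrs E x)) (\<lambda>S. ennreal (p (card S) / real (d choose card S)))"

definition config_measure ::
    "'a set \<Rightarrow> ('a \<times> 'a) set \<Rightarrow> nat \<Rightarrow> (nat \<Rightarrow> real) \<Rightarrow> ('a \<Rightarrow> 'a set) measure" where
  "config_measure V E d p = PiM V (vertex_law E d p)"

(* The restriction to V matters: configurations are undefined outside V. *)
definition open_edges :: "'a set \<Rightarrow> ('a \<Rightarrow> 'a set) \<Rightarrow> ('a \<times> 'a) set" where
  "open_edges V \<omega> = {(x, y). x \<in> V \<and> y \<in> \<omega> x}"

definition weakly_connected :: "'a set \<Rightarrow> ('a \<Rightarrow> 'a set) \<Rightarrow> 'a \<Rightarrow> 'a \<Rightarrow> bool" where
  "weakly_connected V \<omega> x y \<longleftrightarrow> (x, y) \<in> (open_edges V \<omega> \<union> (open_edges V \<omega>)\<inverse>)\<^sup>*"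

definition weak_cluster :: "'a set \<Rightarrow> ('a \<Rightarrow> 'a set) \<Rightarrow> 'a \<Rightarrow> 'a set" where
  "weak_cluster V \<omega> orig = {x \<in> V. weakly_connected V \<omega> orig x}"

(* The cluster size is taken by counting measure, so that an infinite cluster has size
   infinity rather than 0. *)
definition mean_cluster_size ::
    "'a set \<Rightarrow> ('a \<times> 'a) set \<Rightarrow> 'a \<Rightarrow> nat \<Rightarrow> (nat \<Rightarrow> real) \<Rightarrow> ennreal" where
  "mean_cluster_size V E orig d p =
     (\<integral>\<^sup>+ \<omega>. emeasure (count_space UNIV) (weak_cluster V \<omega> orig) \<partial>config_measure V E d p)"

definition reaches_sphere ::
    "'a set \<Rightarrow> ('a \<times> 'a) set \<Rightarrow> 'a \<Rightarrow> nat \<Rightarrow> ('a \<Rightarrow> 'a set) \<Rightarrow> bool" where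
  "reaches_sphere V E orig n \<omega> \<longleftrightarrow> (\<exists>x\<in>graph_sphere V E orig n. weakly_connected V \<omega> orig x)"

end

(* Let D be the set of vertices reached from the origin in at most r weakly open steps. The event
   D = S is decided by the states in S and its neighbourhood R. If the origin reaches distance
   n + r + 2, then |D| > r (otherwise the steps stop early and D is the whole cluster), and the
   last exit of a weakly open path from R yields a neighbour c of R that reaches distance n from
   itself using only states outside R, an event independent of D = S. By transitivity this costs
   at most the probability rho(n) that the origin reaches distance n, so
     rho(n + r + 2) <= d (d + 1) E[|D|; |D| > r] rho(n).
   The expectation is dominated by E[|C|; |C| > r] and tends to 0 because E|C| < infinity, so the factor is below 1/2 for some r, and rho decays geometrically. Revealing
   the states of the whole neighbourhood R replaces a BK-type inequality, which is not at hand
   since the edges leaving a vertex are dependent. *)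
theory Submission
  imports Defs
begin

subsection \<open>Iterated neighbourhoods and weak edges\<close>

text \<open>Cumulative balls are used in place of exact step counts \<open>W ^^ k\<close>: they
  increase with both the radius and the relation, so weak balls compare with graph balls by plain
  inclusion.\<close>

primrec hop :: "('a \<times> 'a) set \<Rightarrow> 'a \<Rightarrow> nat \<Rightarrow> 'a set" where
  "hop W x 0 = {x}"
| "hop W x (Suc k) = hop W x k \<union> W `` hop W x k"

lemma hop_mono: "k \<le> l \<Longrightarrow> hop W x k \<subseteq> hop W x l"
  by (rule lift_Suc_mono_le[of "hop W x"]) auto

lemma hop_mono_rel: "W \<subseteq> W' \<Longrightarrow> hop W x k \<subseteq> hop W' x k"
  by (induction k) auto

lemma self_in_hop: "x \<in> hop W x k"
  by (induction k) auto

lemma rtrancl_iff_hop: "(x, y) \<in> W\<^sup>* \<longleftrightarrow> (\<exists>k. y \<in> hop W x k)"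
proof
  assume "(x, y) \<in> W\<^sup>*"
  then show "\<exists>k. y \<in> hop W x k"
  proof induction
    case base
    show ?case using self_in_hop by fast
  next
    case (step y z)
    then obtain k where "y \<in> hop W x k" by blast
    with step.hyps have "z \<in> hop W x (Suc k)" by auto
    then show ?case by blast
  qed
next
  have "y \<in> hop W x k \<Longrightarrow> (x, y) \<in> W\<^sup>*" for y k
    by (induction k arbitrary: y) (auto intro: rtrancl_into_rtrancl)
  then show "\<exists>k. y \<in> hop W x k \<Longrightarrow> (x, y) \<in> W\<^sup>*" by blast
qed

lemma hop_trans: "y \<in> hop W x j \<Longrightarrow> z \<in> hop W y k \<Longrightarrow> z \<in> hop W x (j + k)"
  by (induction k arbitrary: z) auto

lemma hop_relpow: "y \<in> hop W x k \<Longrightarrow> \<exists>j\<le>k. (x, y) \<in> W ^^ j"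
proof (induction k arbitrary: y)
  case 0
  then show ?case by auto
next
  case (Suc k)
  consider "y \<in> hop W x k" | z where "z \<in> hop W x k" "(z, y) \<in> W"
    using Suc.prems by auto
  then show ?case
  proof cases
    case 1
    then show ?thesis using Suc.IH le_SucI by blast
  next
    case 2
    then obtain j where "j \<le> k" "(x, z) \<in> W ^^ j" using Suc.IH by blast
    with 2 show ?thesis by (intro exI[of _ "Suc j"]) auto
  qed
qed

lemma graph_dist_le_hop: "y \<in> hop W x k \<Longrightarrow> graph_dist W x y \<le> k"
  unfolding graph_dist_def by (drule hop_relpow) (meson Least_le le_trans)

text \<open>A ball that gains nothing in one step contains its own image under \<open>W\<close>, so
  it absorbs all other balls around x.\<close>

lemma hop_stable:
  assumes "hop W x (Suc k) = hop W x k"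
  shows "hop W x l \<subseteq> hop W x k"
  using assms by (induction l) (auto simp: self_in_hop)

text \<open>Until the balls stop growing, each step adds at least one vertex to the initial one;
  once they stop, the current ball holds everything reachable. A reachable vertex outside the ball
  of radius r thus forces more than r vertices inside it.\<close>

lemma hop_card_or_closed:
  assumes "\<And>k. finite (hop W x k)"
  shows "r < card (hop W x r) \<or> (\<forall>l. hop W x l \<subseteq> hop W x r)"
proof (induction r)
  case 0
  show ?case by simp
next
  case (Suc r)
  show ?case
  proof (cases "hop W x (Suc r) = hop W x r")
    case True
    then show ?thesis using hop_stable[OF True] by simp
  next
    case False
    then have "hop W x r \<subset> hop W x (Suc r)" using hop_mono[of r "Suc r" W x] by auto
    then have "card (hop W x r) < card (hop W x (Suc r))"
      by (intro psubset_card_mono assms)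
    \<comment> \<open>The other alternative of the induction hypothesis would make the two balls
      equal.\<close>
    moreover have "r < card (hop W x r)"
      using Suc False by (metis hop_mono lessI less_imp_le subset_antisym)
    ultimately show ?thesis by simp
  qed
qed

section \<open>Weak connections through the states in a given vertex set\<close>

definition weak_edges :: "'a set \<Rightarrow> ('a \<Rightarrow> 'a set) \<Rightarrow> ('a \<times> 'a) set" where
  "weak_edges I \<omega> = open_edges I \<omega> \<union> (open_edges I \<omega>)\<inverse>"

lemma weak_edges_iff:
  "(x, y) \<in> weak_edges I \<omega> \<longleftrightarrow> x \<in> I \<and> y \<in> \<omega> x \<or> y \<in> I \<and> x \<in> \<omega> y"
  by (auto simp: weak_edges_def open_edges_def)

lemma weak_edges_mono: "I \<subseteq> J \<Longrightarrow> weak_edges I \<omega> \<subseteq> weak_edges J \<omega>"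
  by (auto simp: weak_edges_iff)

text \<open>An edge may have an endpoint outside I, but only states in I decide it. Connections in
  \<open>weak_edges I\<close> are therefore events of the coordinates in I, the form that
  independence requires.\<close>

lemma weak_edges_restrict: "weak_edges I (restrict \<omega> I) = weak_edges I \<omega>"
  by (auto simp: weak_edges_iff)

lemma weakly_connected_iff_hop:
  "weakly_connected I \<omega> x y \<longleftrightarrow> (\<exists>k. y \<in> hop (weak_edges I \<omega>) x k)"
  unfolding weakly_connected_def weak_edges_def rtrancl_iff_hop ..

text \<open>Distance at least n, instead of exactly n, makes the event decrease in n. Distance is
  always measured in the full graph E, even when only the states in I may be used; hence enlarging I
  enlarges the event.\<close>

definition reaches_far ::
    "('a \<times> 'a) set \<Rightarrow> 'a set \<Rightarrow> 'a \<Rightarrow> nat \<Rightarrow> ('a \<Rightarrow> 'a set) \<Rightarrow> bool" where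
  "reaches_far E I c n \<omega> \<longleftrightarrow>
     (\<exists>x. weakly_connected I \<omega> c x \<and> (\<forall>k<n. x \<notin> hop E c k))"

lemma reaches_far_antimono: "m \<le> n \<Longrightarrow> reaches_far E I c n \<omega> \<Longrightarrow> reaches_far E I c m \<omega>"
  unfolding reaches_far_def by (meson less_le_trans)

lemma reaches_far_restrict: "reaches_far E I c n (restrict \<omega> I) \<longleftrightarrow> reaches_far E I c n \<omega>"
  by (simp add: reaches_far_def weakly_connected_iff_hop weak_edges_restrict)

lemma reaches_far_mono: "I \<subseteq> J \<Longrightarrow> reaches_far E I c n \<omega> \<Longrightarrow> reaches_far E J c n \<omega>"
  unfolding reaches_far_def weakly_connected_iff_hop
  by (meson hop_mono_rel subsetD weak_edges_mono)

lemma reaches_sphere_imp_far: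
  "reaches_sphere V E c n \<omega> \<Longrightarrow> reaches_far E V c n \<omega>"
  unfolding reaches_sphere_def reaches_far_def graph_sphere_def
  using graph_dist_le_hop by fastforce

text \<open>After the last visit to R both endpoints of each edge lie outside R, so the edge is
  decided by states outside R. The induction runs from the end of the path back to its start; the
  first alternative covers final segments that have not yet met R.\<close>

lemma last_exit:
  assumes "(z, x) \<in> (weak_edges V \<omega>)\<^sup>*" "x \<notin> R"
  shows "(z \<notin> R \<and> (z, x) \<in> (weak_edges (V - R) \<omega>)\<^sup>*) \<or>
    (\<exists>a\<in>R. \<exists>c. (a, c) \<in> weak_edges V \<omega> \<and> (c, x) \<in> (weak_edges (V - R) \<omega>)\<^sup>*)"
  using assms(1)
proof (induction rule: converse_rtrancl_induct)
  case base
  then show ?case using assms(2) by simp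
next
  case (step z y)
  show ?case
  proof (cases "z \<in> R")
    case True
    then show ?thesis using step by blast
  next
    case False
    show ?thesis
    proof (cases "y \<notin> R \<and> (y, x) \<in> (weak_edges (V - R) \<omega>)\<^sup>*")
      case True
      with False step.hyps(1) have "(z, y) \<in> weak_edges (V - R) \<omega>"
        by (auto simp: weak_edges_iff)
      then show ?thesis using True False by (meson converse_rtrancl_into_rtrancl)
    next
      case False
      then show ?thesis using step.IH by blast
    qed
  qed
qed

text \<open>An exploration that ends in S only follows edges that start in S. These end in R, so
  both of their deciding states lie in R. Hence the event that the exploration yields S is
  determined by the states in R.\<close>

lemma hop_weak_edges_local:
  assumes nb: "\<And>z y. z \<in> S \<Longrightarrow> (z, y) \<in> weak_edges V \<omega> \<Longrightarrow> y \<in> R"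
    and "S \<subseteq> R" "R \<subseteq> V"
  shows "hop (weak_edges V \<omega>) x r = S \<longleftrightarrow> hop (weak_edges R \<omega>) x r = S"
proof -
  \<comment> \<open>Knowing the outcome S for either exploration is enough: as long as the two
    agree, their common ball lies in S, and there both see the same edges.\<close>
  have *: "hop (weak_edges V \<omega>) x k = hop (weak_edges R \<omega>) x k"
    if "hop (weak_edges V \<omega>) x r = S \<or> hop (weak_edges R \<omega>) x r = S" "k \<le> r" for k
    using that(2)
  proof (induction k)
    case 0
    show ?case by simp
  next
    case (Suc k)
    let ?H = "hop (weak_edges V \<omega>) x k"
    have eq: "?H = hop (weak_edges R \<omega>) x k" using Suc by simp
    have "?H \<subseteq> S"
      using that(1) eq hop_mono[of k r] Suc.prems by (metis Suc_leD)
    then have "(z, y) \<in> weak_edges R \<omega>" if "z \<in> ?H" "(z, y) \<in> weak_edges V \<omega>" for z y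
      using that nb[of z y] \<open>S \<subseteq> R\<close> by (auto simp: weak_edges_iff)
    then have "weak_edges V \<omega> `` ?H = weak_edges R \<omega> `` ?H"
      using weak_edges_mono[OF \<open>R \<subseteq> V\<close>, of \<omega>] by blast
    then show ?case using eq by simp
  qed
  show ?thesis using * by blast
qed

subsection \<open>The percolation measure\<close>

locale percolation =
  fixes V :: "'a set" and E :: "('a \<times> 'a) set" and d :: nat and p :: "nat \<Rightarrow> real"
  assumes simple: "simple_symmetric_digraph V E"
    and regular: "regular_digraph V E d"
    and transitive: "vertex_transitive V E"
    and prob: "prob_vector d p"
begin

abbreviation law :: "'a \<Rightarrow> 'a set measure" where
  "law \<equiv> vertex_law E d p"

abbreviation Om :: "('a \<Rightarrow> 'a set) measure" where
  "Om \<equiv> config_measure V E d p"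

lemma countable_V: "countable V" and E_sub: "E \<subseteq> V \<times> V" and sym_E: "sym E"
  using simple by (auto simp: simple_symmetric_digraph_def)

lemma E_sym: "(x, y) \<in> E \<Longrightarrow> (y, x) \<in> E"
  using sym_E by (rule symD)

lemma finite_nbrs: "finite (nbrs E x)"
proof (cases "x \<in> V")
  case False
  then have "nbrs E x = {}" using E_sub by (auto simp: nbrs_def)
  then show ?thesis by simp
qed (use regular in \<open>auto simp: regular_digraph_def\<close>)

lemma card_nbrs: "x \<in> V \<Longrightarrow> card (nbrs E x) = d"
  using regular by (auto simp: regular_digraph_def)

lemma nbrs_sub: "nbrs E x \<subseteq> V"
  using E_sub by (auto simp: nbrs_def)

lemma sets_law: "sets (law x) = Pow (Pow (nbrs E x))"
  by (simp add: vertex_law_def sets_point_measure)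

lemma space_law: "space (law x) = Pow (nbrs E x)"
  by (simp add: vertex_law_def space_point_measure)

lemma emeasure_law:
  "A \<subseteq> Pow (nbrs E x) \<Longrightarrow>
    emeasure (law x) A = (\<Sum>S\<in>A. ennreal (p (card S) / real (d choose card S)))"
  unfolding vertex_law_def by (rule emeasure_point_measure_finite) (simp_all add: finite_nbrs)

text \<open>Grouped by size, the subsets of size k number \<open>d choose k\<close>, which cancels
  the denominator and leaves the total weight \<open>p k\<close>.\<close>

lemma prob_space_law:
  assumes "x \<in> V"
  shows "prob_space (law x)"
proof
  let ?N = "nbrs E x"
  have card_le: "card S \<le> d" if "S \<subseteq> ?N" for S
    using card_mono[OF finite_nbrs that] card_nbrs[OF assms] by simp
  have "(\<Sum>S\<in>Pow ?N. p (card S) / real (d choose card S))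
      = (\<Sum>k\<le>d. \<Sum>S\<in>{S\<in>Pow ?N. card S = k}. p (card S) / real (d choose card S))"
    by (rule sum.group[symmetric]) (use card_le finite_nbrs in auto)
  also have "\<dots> = (\<Sum>k\<le>d. p k)"
  proof (rule sum.cong[OF refl])
    fix k assume "k \<in> {..d}"
    have "card {S\<in>Pow ?N. card S = k} = d choose k"
      using n_subsets[OF finite_nbrs, of x k] card_nbrs[OF assms] by (simp add: Pow_def)
    then show "(\<Sum>S\<in>{S\<in>Pow ?N. card S = k}. p (card S) / real (d choose card S)) = p k"
      using \<open>k \<in> {..d}\<close> by simp
  qed
  also have "\<dots> = 1" using prob by (simp add: prob_vector_def)
  finally have "(\<Sum>S\<in>Pow ?N. p (card S) / real (d choose card S)) = 1" .
  moreover have "0 \<le> p (card S) / real (d choose card S)" if "S \<in> Pow ?N" for S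
    using prob card_le that by (simp add: prob_vector_def)
  ultimately show "emeasure (law x) (space (law x)) = 1"
    by (subst space_law, subst emeasure_law) (simp_all only: sum_ennreal order_refl ennreal_1)
qed

sublocale Om: prob_space Om
  unfolding config_measure_def by (rule prob_space_PiM) (rule prob_space_law)

lemma space_PiM_law: "\<omega> \<in> space (PiM I law) \<Longrightarrow> x \<in> I \<Longrightarrow> \<omega> x \<subseteq> nbrs E x"
  by (auto simp: space_PiM space_law PiE_iff)

text \<open>This holds surely, since points of the product space have sets of neighbours as states.
  It confines weak balls to finite graph balls, which drives all the measurability
  arguments.\<close>

lemma weak_edges_sub_E: "\<omega> \<in> space (PiM I law) \<Longrightarrow> weak_edges I \<omega> \<subseteq> E"
  using space_PiM_law E_sym by (fastforce simp: weak_edges_iff nbrs_def)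

lemma weak_edges_sub_E': "\<omega> \<in> space Om \<Longrightarrow> weak_edges V \<omega> \<subseteq> E"
  unfolding config_measure_def by (rule weak_edges_sub_E)

lemma finite_hop_E: "finite (hop E x k)"
proof (induction k)
  case (Suc k)
  have "E `` hop E x k = (\<Union>y\<in>hop E x k. nbrs E y)" by (auto simp: nbrs_def)
  then show ?case using Suc finite_nbrs by simp
qed simp

lemma hop_E_sub: "x \<in> V \<Longrightarrow> hop E x k \<subseteq> V"
  using E_sub by (induction k) auto

lemma hop_weak_sub: "\<omega> \<in> space Om \<Longrightarrow> hop (weak_edges V \<omega>) x k \<subseteq> hop E x k"
  by (intro hop_mono_rel weak_edges_sub_E')

section \<open>Measurability of connection events\<close>

lemma measurable_open [measurable]:
  "Measurable.pred (PiM I law) (\<lambda>\<omega>. x \<in> I \<and> y \<in> \<omega> x)"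
proof (cases "x \<in> I")
  case True
  have "(\<lambda>S. y \<in> S) \<in> measurable (law x) (count_space UNIV)"
    by (rule measurableI) (auto simp: sets_law space_law)
  from measurable_compose[OF measurable_component_singleton[OF True, of law] this]
  show ?thesis using True by simp
qed simp

lemma measurable_hop:
  assumes "I \<subseteq> V" "x \<in> V"
  shows "Measurable.pred (PiM I law) (\<lambda>\<omega>. y \<in> hop (weak_edges I \<omega>) x k)"
proof (induction k arbitrary: y)
  case 0
  show ?case by simp
next
  case (Suc k)
  note Suc.IH[measurable]
  note [measurable (raw)] = pred_intros_finite(4)[OF finite_hop_E]
  \<comment> \<open>The predecessor z is sought in the graph ball, so the existential is a finite
    union.\<close>
  have "y \<in> hop (weak_edges I \<omega>) x (Suc k) \<longleftrightarrow> y \<in> hop (weak_edges I \<omega>) x k \<or>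
      (\<exists>z\<in>hop E x k. z \<in> hop (weak_edges I \<omega>) x k \<and> (z \<in> I \<and> y \<in> \<omega> z \<or> y \<in> I \<and> z \<in> \<omega> y))"
    if "\<omega> \<in> space (PiM I law)" for \<omega>
    using hop_mono_rel[OF weak_edges_sub_E[OF that], of x k]
    by (auto simp: weak_edges_iff)
  then show ?case by (subst measurable_cong) (assumption, measurable)
qed

lemma measurable_weakly_connected:
  assumes "I \<subseteq> V" "x \<in> V"
  shows "Measurable.pred (PiM I law) (\<lambda>\<omega>. weakly_connected I \<omega> x y)"
proof -
  note measurable_hop[OF assms, measurable]
  show ?thesis unfolding weakly_connected_iff_hop by measurable
qed

lemma measurable_reaches_far:
  assumes "I \<subseteq> V" "x \<in> V"
  shows "Measurable.pred (PiM I law) (reaches_far E I x n)"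
proof -
  note measurable_weakly_connected[OF assms, measurable]
  \<comment> \<open>Graph balls around x stay in V, so the endpoint ranges over a countable
    set.\<close>
  have "reaches_far E I x n \<omega> \<longleftrightarrow> (\<exists>y\<in>V. weakly_connected I \<omega> x y \<and> (\<forall>k<n. y \<notin> hop E x k))"
    if "\<omega> \<in> space (PiM I law)" for \<omega>
    unfolding reaches_far_def weakly_connected_iff_hop
    using hop_mono_rel[OF weak_edges_sub_E[OF that], of x] hop_E_sub[OF assms(2)]
    by blast
  moreover have "Measurable.pred (PiM I law)
      (\<lambda>\<omega>. \<exists>y\<in>V. weakly_connected I \<omega> x y \<and> (\<forall>k<n. y \<notin> hop E x k))"
    unfolding pred_def
    by (rule sets.sets_Collect_countable_Ex'[OF _ countable_V]) measurable
  ultimately show ?thesis by (subst measurable_cong)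
qed

lemma measurable_hop_eq:
  assumes "I \<subseteq> V" "x \<in> V"
  shows "Measurable.pred (PiM I law) (\<lambda>\<omega>. hop (weak_edges I \<omega>) x k = S)"
proof (cases "S \<subseteq> hop E x k")
  case True
  note measurable_hop[OF assms, measurable]
  note [measurable (raw)] = pred_intros_finite(3)[OF finite_hop_E]
  have "hop (weak_edges I \<omega>) x k = S \<longleftrightarrow> (\<forall>y\<in>hop E x k. y \<in> hop (weak_edges I \<omega>) x k \<longleftrightarrow> y \<in> S)"
    if "\<omega> \<in> space (PiM I law)" for \<omega>
    using hop_mono_rel[OF weak_edges_sub_E[OF that], of x k] True
    by blast
  then show ?thesis by (subst measurable_cong) (assumption, measurable)
next
  case False
  have "hop (weak_edges I \<omega>) x k \<noteq> S" if "\<omega> \<in> space (PiM I law)" for \<omega>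
    using hop_mono_rel[OF weak_edges_sub_E[OF that], of x k] False
    by blast
  then show ?thesis by (subst measurable_cong[where g = "\<lambda>_. False"]) auto
qed

section \<open>Independence over disjoint vertex sets\<close>

lemma restrict_measurable_Om: "I \<subseteq> V \<Longrightarrow> (\<lambda>\<omega>. restrict \<omega> I) \<in> measurable Om (PiM I law)"
  unfolding config_measure_def by (rule measurable_restrict_subset)

lemma emeasure_indep:
  assumes AB: "A \<inter> B = {}" "A \<subseteq> V" "B \<subseteq> V"
    and P: "Measurable.pred (PiM A law) P" and Q: "Measurable.pred (PiM B law) Q"
  shows "emeasure Om {\<omega>\<in>space Om. P (restrict \<omega> A) \<and> Q (restrict \<omega> B)} =
    emeasure Om {\<omega>\<in>space Om. P (restrict \<omega> A)} * emeasure Om {\<omega>\<in>space Om. Q (restrict \<omega> B)}"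
proof -
  have "V \<noteq> {}" using simple by (auto simp: simple_symmetric_digraph_def)
  have rv: "(\<lambda>\<omega>. \<omega> x) \<in> measurable Om (law x)" if "x \<in> V" for x
    unfolding config_measure_def using that by simp
  \<comment> \<open>Independence of the coordinates is obtained in the form: their joint law is the
    product of their marginals.\<close>
  have "distr Om (PiM V law) (\<lambda>\<omega>. \<lambda>x\<in>V. \<omega> x) = PiM V (\<lambda>x. distr Om (law x) (\<lambda>\<omega>. \<omega> x))"
  proof -
    have "distr Om (PiM V law) (\<lambda>\<omega>. \<lambda>x\<in>V. \<omega> x) = distr Om Om (\<lambda>\<omega>. \<omega>)"
      by (rule distr_cong) (auto simp: config_measure_def space_PiM)
    also have "\<dots> = PiM V law" by (simp add: config_measure_def)
    also have "\<dots> = PiM V (\<lambda>x. distr Om (law x) (\<lambda>\<omega>. \<omega> x))"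
      unfolding config_measure_def
      by (rule PiM_cong[OF refl]) (simp add: distr_PiM_component prob_space_law)
    finally show ?thesis .
  qed
  then have "Om.indep_vars law (\<lambda>x \<omega>. \<omega> x) V"
    using Om.indep_vars_iff_distr_eq_PiM'[OF \<open>V \<noteq> {}\<close> rv] by simp
  from Om.indep_var_restrict[OF this AB]
  have ind: "Om.indep_var (PiM A law) (\<lambda>\<omega>. restrict \<omega> A) (PiM B law) (\<lambda>\<omega>. restrict \<omega> B)" .
  have sets: "{\<omega>\<in>space (PiM A law). P \<omega>} \<in> sets (PiM A law)"
    "{\<omega>\<in>space (PiM B law). Q \<omega>} \<in> sets (PiM B law)"
    using P Q by (auto simp: pred_def)
  have in_space: "restrict \<omega> I \<in> space (PiM I law)" if "\<omega> \<in> space Om" "I \<subseteq> V" for \<omega> I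
    using measurable_space[OF restrict_measurable_Om] that by blast
  have eqs: "(\<lambda>\<omega>. (restrict \<omega> A, restrict \<omega> B)) -`
        ({\<omega>\<in>space (PiM A law). P \<omega>} \<times> {\<omega>\<in>space (PiM B law). Q \<omega>}) \<inter> space Om =
      {\<omega>\<in>space Om. P (restrict \<omega> A) \<and> Q (restrict \<omega> B)}"
    "(\<lambda>\<omega>. restrict \<omega> A) -` {\<omega>\<in>space (PiM A law). P \<omega>} \<inter> space Om =
      {\<omega>\<in>space Om. P (restrict \<omega> A)}"
    "(\<lambda>\<omega>. restrict \<omega> B) -` {\<omega>\<in>space (PiM B law). Q \<omega>} \<inter> space Om =
      {\<omega>\<in>space Om. Q (restrict \<omega> B)}"
    using in_space AB by auto
  show ?thesis
    using Om.indep_varD[OF ind sets] unfolding eqs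
    by (simp add: Om.emeasure_eq_measure ennreal_mult'')
qed

lemma sets_reaches_far:
  assumes "I \<subseteq> V" "x \<in> V"
  shows "{\<omega>\<in>space Om. reaches_far E I x n \<omega>} \<in> sets Om"
  using measurable_sets_Collect[OF restrict_measurable_Om[OF assms(1)],
      of "reaches_far E I x n"] measurable_reaches_far[OF assms, of n]
  by (simp add: reaches_far_restrict pred_def)

lemma sets_hop_eq:
  assumes "I \<subseteq> V" "x \<in> V"
  shows "{\<omega>\<in>space Om. hop (weak_edges I \<omega>) x k = S} \<in> sets Om"
  using measurable_sets_Collect[OF restrict_measurable_Om[OF assms(1)],
      of "\<lambda>\<omega>. hop (weak_edges I \<omega>) x k = S"] measurable_hop_eq[OF assms, of k S]
  by (simp add: weak_edges_restrict pred_def)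

text \<open>This is rho of the overview, with an arbitrary centre c.\<close>

definition far_prob :: "'a \<Rightarrow> nat \<Rightarrow> ennreal" where
  "far_prob c n = emeasure Om {\<omega>\<in>space Om. reaches_far E V c n \<omega>}"

lemma far_prob_antimono: "c \<in> V \<Longrightarrow> m \<le> n \<Longrightarrow> far_prob c n \<le> far_prob c m"
  unfolding far_prob_def
  by (intro emeasure_mono sets_reaches_far) (auto intro: reaches_far_antimono)

lemma far_prob_le_1: "far_prob c n \<le> 1"
  unfolding far_prob_def by (rule Om.emeasure_le_1)

subsection \<open>Invariance under automorphisms\<close>

text \<open>Transport of configurations chosen so that \<phi> carries the weak edges of \<omega> to
  those of the image. Restriction to V keeps the result extensional, hence a point of the product
  space.\<close>

definition push :: "('a \<Rightarrow> 'a) \<Rightarrow> ('a \<Rightarrow> 'a set) \<Rightarrow> 'a \<Rightarrow> 'a set" where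
  "push \<phi> \<omega> = (\<lambda>y\<in>V. \<phi> ` \<omega> (inv_into V \<phi> y))"

context
  fixes \<phi> assumes aut: "digraph_automorphism V E \<phi>"
begin

private abbreviation (input) \<psi> where "\<psi> \<equiv> inv_into V \<phi>"

lemma bij_aut: "bij_betw \<phi> V V"
  using aut by (simp add: digraph_automorphism_def)

lemma aut_simps:
  "x \<in> V \<Longrightarrow> \<phi> x \<in> V" "x \<in> V \<Longrightarrow> \<psi> x \<in> V" "x \<in> V \<Longrightarrow> \<phi> (\<psi> x) = x" "x \<in> V \<Longrightarrow> \<psi> (\<phi> x) = x"
  using bij_aut by (auto simp: bij_betw_def inj_on_def f_inv_into_f inv_into_f_f intro: inv_into_into)

lemma aut_E: "x \<in> V \<Longrightarrow> y \<in> V \<Longrightarrow> (\<phi> x, \<phi> y) \<in> E \<longleftrightarrow> (x, y) \<in> E"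
  using aut by (simp add: digraph_automorphism_def)

lemma aut_nbrs: "x \<in> V \<Longrightarrow> \<phi> ` nbrs E x = nbrs E (\<phi> x)"
proof (intro equalityI subsetI)
  fix y assume x: "x \<in> V" and "y \<in> nbrs E (\<phi> x)"
  then have y: "y \<in> V" "(\<phi> x, y) \<in> E" using nbrs_sub by (auto simp: nbrs_def)
  then have "(x, \<psi> y) \<in> E" using aut_E[OF x, of "\<psi> y"] aut_simps by simp
  then show "y \<in> \<phi> ` nbrs E x"
    using aut_simps(3)[OF y(1)] by (metis imageI mem_Collect_eq nbrs_def)
qed (use aut_E nbrs_sub in \<open>fastforce simp: nbrs_def\<close>)

lemma push_component: "x \<in> V \<Longrightarrow> push \<phi> \<omega> (\<phi> x) = \<phi> ` \<omega> x"
  by (simp add: push_def aut_simps)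

lemma aut_hop: "x \<in> V \<Longrightarrow> y \<in> V \<Longrightarrow> \<phi> y \<in> hop E (\<phi> x) k \<longleftrightarrow> y \<in> hop E x k"
proof (induction k arbitrary: y)
  case 0
  then show ?case using bij_aut by (auto simp: bij_betw_def inj_on_def)
next
  case (Suc k)
  have "(\<exists>z\<in>hop E (\<phi> x) k. (z, \<phi> y) \<in> E) \<longleftrightarrow> (\<exists>z\<in>hop E x k. (z, y) \<in> E)"
  proof
    assume "\<exists>z\<in>hop E (\<phi> x) k. (z, \<phi> y) \<in> E"
    then obtain z where z: "z \<in> hop E (\<phi> x) k" "(z, \<phi> y) \<in> E" by blast
    then have "z \<in> V" using E_sub by auto
    then show "\<exists>z\<in>hop E x k. (z, y) \<in> E"
      using z Suc.IH[of "\<psi> z"] Suc.prems aut_simps(2,3)[of z] aut_E[of "\<psi> z" y] by metis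
  next
    assume "\<exists>z\<in>hop E x k. (z, y) \<in> E"
    then obtain z where z: "z \<in> hop E x k" "(z, y) \<in> E" by blast
    then have "z \<in> V" using E_sub by auto
    then show "\<exists>z\<in>hop E (\<phi> x) k. (z, \<phi> y) \<in> E"
      using z Suc.IH[of z] Suc.prems aut_E[of z y] by metis
  qed
  then show ?case using Suc.IH[of y] Suc.prems by (simp add: Image_iff)
qed

text \<open>Membership in V is carried along because \<open>push_component\<close> describes the
  transported state only at images of vertices of V.\<close>

lemma push_weakly_connected:
  assumes \<omega>: "\<omega> \<in> space Om" and "weakly_connected V \<omega> x y" "x \<in> V"
  shows "y \<in> V \<and> weakly_connected V (push \<phi> \<omega>) (\<phi> x) (\<phi> y)"
  using assms(2) unfolding weakly_connected_def weak_edges_def[symmetric]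
proof (induction rule: rtrancl_induct)
  case base
  then show ?case using assms(3) by simp
next
  case (step y z)
  have "z \<in> V" using step.hyps(2) weak_edges_sub_E'[OF \<omega>] E_sub by auto
  moreover have "(\<phi> y, \<phi> z) \<in> weak_edges V (push \<phi> \<omega>)"
    using step \<open>z \<in> V\<close> by (auto simp: weak_edges_iff push_component aut_simps)
  ultimately show ?case using step.IH by (auto intro: rtrancl_into_rtrancl)
qed

lemma push_reaches_far:
  assumes "\<omega> \<in> space Om" "c \<in> V" "reaches_far E V c n \<omega>"
  shows "reaches_far E V (\<phi> c) n (push \<phi> \<omega>)"
  using assms push_weakly_connected[OF assms(1)] aut_hop unfolding reaches_far_def by meson

text \<open>The weight of a state depends only on its size, and taking images under \<phi> is a
  size-preserving bijection between the subsets of the two neighbourhoods.\<close>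

lemma law_aut:
  assumes "x \<in> V" "A \<subseteq> Pow (nbrs E (\<phi> x))"
  shows "emeasure (law x) {S\<in>Pow (nbrs E x). \<phi> ` S \<in> A} = emeasure (law (\<phi> x)) A"
proof -
  let ?B = "{S\<in>Pow (nbrs E x). \<phi> ` S \<in> A}"
  have inj: "inj_on \<phi> (nbrs E x)"
    using bij_aut nbrs_sub by (auto simp: bij_betw_def intro: inj_on_subset)
  have image: "(`) \<phi> ` ?B = A"
  proof (intro equalityI subsetI)
    fix T assume "T \<in> A"
    then have "T \<subseteq> \<phi> ` nbrs E x" using assms aut_nbrs by auto
    then obtain S where "S \<subseteq> nbrs E x" "T = \<phi> ` S" by (rule subset_imageE)
    then show "T \<in> (`) \<phi> ` ?B" using \<open>T \<in> A\<close> by auto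
  qed auto
  have "emeasure (law (\<phi> x)) A = (\<Sum>S\<in>(`) \<phi> ` ?B. ennreal (p (card S) / real (d choose card S)))"
    unfolding image using assms(2) by (rule emeasure_law)
  also have "\<dots> = (\<Sum>S\<in>?B. ennreal (p (card (\<phi> ` S)) / real (d choose card (\<phi> ` S))))"
    by (subst sum.reindex)
      (auto intro!: inj_on_subset[OF inj_on_image_Pow[OF inj]])
  also have "\<dots> = (\<Sum>S\<in>?B. ennreal (p (card S) / real (d choose card S)))"
    by (rule sum.cong[OF refl]) (auto simp: card_image inj_on_subset[OF inj])
  also have "\<dots> = emeasure (law x) ?B"
    by (rule emeasure_law[symmetric]) auto
  finally show ?thesis ..
qed

lemma push_measurable: "push \<phi> \<in> measurable Om Om"
  unfolding push_def config_measure_def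
proof (rule measurable_restrict)
  fix y assume "y \<in> V"
  then have y: "\<psi> y \<in> V" "\<phi> (\<psi> y) = y" by (simp_all add: aut_simps)
  have "(\<lambda>S. \<phi> ` S) \<in> measurable (law (\<psi> y)) (law y)"
    using aut_nbrs[OF y(1)] y(2)
    by (intro measurableI) (auto simp: sets_law space_law)
  from measurable_compose[OF measurable_component_singleton[OF y(1), of law] this]
  show "(\<lambda>\<omega>. \<phi> ` \<omega> (\<psi> y)) \<in> measurable (PiM V law) (law y)" .
qed

text \<open>A measure on the infinite product is determined by finite cylinders. The preimage of a
  cylinder over J is a cylinder over the inverse image of J, and \<open>law_aut\<close> matches the
  factors one by one.\<close>

lemma distr_push: "distr Om Om (push \<phi>) = Om"
proof (rule measure_eqI_PiM_infinite)
  show "sets (distr Om Om (push \<phi>)) = sets (PiM V law)" "sets Om = sets (PiM V law)"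
    by (simp_all add: config_measure_def)
  show "finite_measure (distr Om Om (push \<phi>))"
    using Om.prob_space_distr[OF push_measurable] by (rule prob_space.finite_measure)
  fix A J assume J: "finite J" "J \<subseteq> V" and A: "\<And>i. i \<in> J \<Longrightarrow> A i \<in> sets (law i)"
  let ?X = "prod_emb V law J (Pi\<^sub>E J A)"
  let ?B = "\<lambda>i. {S\<in>Pow (nbrs E i). \<phi> ` S \<in> A (\<phi> i)}"
  have inj: "inj_on \<psi> J"
    using J aut_simps(3) by (metis inj_on_inverseI subsetD)
  have "?X \<in> sets Om"
    unfolding config_measure_def using J A by (intro sets_PiM_I) auto
  then have "emeasure (distr Om Om (push \<phi>)) ?X = emeasure Om (push \<phi> -` ?X \<inter> space Om)"
    using push_measurable by (rule emeasure_distr[rotated])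
  also have "push \<phi> -` ?X \<inter> space Om = prod_emb V law (\<psi> ` J) (Pi\<^sub>E (\<psi> ` J) ?B)"
  proof -
    have *: "\<omega> \<in> push \<phi> -` ?X \<inter> space Om \<longleftrightarrow>
        \<omega> \<in> space Om \<and> push \<phi> \<omega> \<in> space Om \<and> (\<forall>j\<in>J. \<phi> ` \<omega> (\<psi> j) \<in> A j)" for \<omega>
      using J by (auto simp: prod_emb_def config_measure_def space_PiM push_def PiE_iff subset_eq extensional_def)
    have **: "\<omega> \<in> prod_emb V law (\<psi> ` J) (Pi\<^sub>E (\<psi> ` J) ?B) \<longleftrightarrow>
        \<omega> \<in> space Om \<and> (\<forall>j\<in>J. \<omega> (\<psi> j) \<in> ?B (\<psi> j))" for \<omega>
      using J by (auto simp: prod_emb_def config_measure_def space_PiM PiE_iff)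
    have "\<omega> (\<psi> j) \<in> ?B (\<psi> j) \<longleftrightarrow> \<phi> ` \<omega> (\<psi> j) \<in> A j" if "\<omega> \<in> space Om" "j \<in> J" for \<omega> j
      using that J aut_simps space_PiM_law[of \<omega> V "\<psi> j"] by (auto simp: config_measure_def subset_eq)
    then have "\<omega> \<in> push \<phi> -` ?X \<inter> space Om \<longleftrightarrow>
        \<omega> \<in> prod_emb V law (\<psi> ` J) (Pi\<^sub>E (\<psi> ` J) ?B)" for \<omega>
      unfolding * ** using measurable_space[OF push_measurable, of \<omega>] by blast
    then show ?thesis by (rule set_eqI)
  qed
  also have "emeasure Om \<dots> = (\<Prod>i\<in>\<psi> ` J. emeasure (law i) (?B i))"
    unfolding config_measure_def using J
    by (intro emeasure_PiM_emb prob_space_law) (auto simp: aut_simps sets_law)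
  also have "\<dots> = (\<Prod>j\<in>J. emeasure (law (\<psi> j)) (?B (\<psi> j)))"
    by (subst prod.reindex[OF inj]) simp
  also have "\<dots> = (\<Prod>j\<in>J. emeasure (law j) (A j))"
  proof (rule prod.cong[OF refl])
    fix j assume "j \<in> J"
    then have j: "\<psi> j \<in> V" "\<phi> (\<psi> j) = j" "A j \<subseteq> Pow (nbrs E j)"
      using J A[of j] aut_simps by (auto simp: sets_law)
    then show "emeasure (law (\<psi> j)) (?B (\<psi> j)) = emeasure (law j) (A j)"
      using law_aut[of "\<psi> j" "A j"] by simp
  qed
  also have "\<dots> = emeasure Om ?X"
    unfolding config_measure_def using J A
    by (intro emeasure_PiM_emb[symmetric] prob_space_law) auto
  finally show "emeasure (distr Om Om (push \<phi>)) ?X = emeasure Om ?X" .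
qed

text \<open>One inclusion of events suffices: transitivity yields an automorphism for each ordered
  pair of vertices, so both inequalities follow.\<close>

lemma far_prob_aut_le:
  assumes "c \<in> V"
  shows "far_prob c n \<le> far_prob (\<phi> c) n"
proof -
  let ?F = "{\<omega>\<in>space Om. reaches_far E V (\<phi> c) n \<omega>}"
  have F: "?F \<in> sets Om" using assms aut_simps by (intro sets_reaches_far) auto
  have "far_prob c n \<le> emeasure Om (push \<phi> -` ?F \<inter> space Om)"
    unfolding far_prob_def
    using push_reaches_far[OF _ assms] measurable_space[OF push_measurable]
    by (intro emeasure_mono measurable_sets[OF push_measurable F]) auto
  also have "\<dots> = emeasure (distr Om Om (push \<phi>)) ?F"
    using push_measurable F by (rule emeasure_distr[symmetric])
  finally show ?thesis by (simp add: distr_push far_prob_def)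
qed

end

lemma far_prob_le:
  assumes "c \<in> V" "x \<in> V"
  shows "far_prob c n \<le> far_prob x n"
  using transitive assms far_prob_aut_le unfolding vertex_transitive_def by metis

subsection \<open>Exponential decay\<close>

text \<open>The integrand of E[|D|; |D| > r] in the overview. On \<open>space Om\<close> the ball is
  finite, so \<open>card\<close> gives its true size.\<close>

definition hop_tail :: "'a \<Rightarrow> nat \<Rightarrow> ('a \<Rightarrow> 'a set) \<Rightarrow> ennreal" where
  "hop_tail x r \<omega> = (let m = card (hop (weak_edges V \<omega>) x r) in if r < m then of_nat m else 0)"

text \<open>The explored set takes only finitely many values, all subsets of the graph ball, and at
  most one indicator in the sum is nonzero.\<close>

lemma hop_tail_eq_sum:
  assumes "\<omega> \<in> space Om"
  shows "hop_tail x r \<omega> = (\<Sum>S\<in>{S\<in>Pow (hop E x r). r < card S}.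
    of_nat (card S) * indicator {\<omega>\<in>space Om. hop (weak_edges V \<omega>) x r = S} \<omega>)"
proof -
  let ?H = "hop (weak_edges V \<omega>) x r"
  have "(\<Sum>S\<in>{S\<in>Pow (hop E x r). r < card S}.
        of_nat (card S) * indicator {\<omega>\<in>space Om. hop (weak_edges V \<omega>) x r = S} \<omega>) =
      (\<Sum>S\<in>{S\<in>Pow (hop E x r). r < card S}. if ?H = S then of_nat (card S) else 0 :: ennreal)"
    using assms by (intro sum.cong) (auto simp: indicator_def)
  also have "\<dots> = hop_tail x r \<omega>"
    using hop_weak_sub[OF assms, of x r] finite_hop_E[of x r]
    by (auto simp: hop_tail_def Let_def sum.delta')
  finally show ?thesis ..
qed

lemma nn_integral_hop_tail:
  assumes "x \<in> V"
  shows "(\<integral>\<^sup>+\<omega>. hop_tail x r \<omega> \<partial>Om) = (\<Sum>S\<in>{S\<in>Pow (hop E x r). r < card S}.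
    of_nat (card S) * emeasure Om {\<omega>\<in>space Om. hop (weak_edges V \<omega>) x r = S})"
proof -
  note sets_hop_eq[OF order_refl assms, measurable]
  have "(\<integral>\<^sup>+\<omega>. hop_tail x r \<omega> \<partial>Om) = (\<integral>\<^sup>+\<omega>. (\<Sum>S\<in>{S\<in>Pow (hop E x r). r < card S}.
      of_nat (card S) * indicator {\<omega>\<in>space Om. hop (weak_edges V \<omega>) x r = S} \<omega>) \<partial>Om)"
    by (rule nn_integral_cong) (rule hop_tail_eq_sum)
  then show ?thesis by (simp add: nn_integral_sum nn_integral_cmult_indicator)
qed

lemma far_prob_step:
  assumes x0: "x\<^sub>0 \<in> V"
  shows "far_prob x\<^sub>0 (n + r + 2) \<le>
    of_nat (d * (d + 1)) * (\<integral>\<^sup>+\<omega>. hop_tail x\<^sub>0 r \<omega> \<partial>Om) * far_prob x\<^sub>0 n"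
proof -
  \<comment> \<open>\<open>F\<close> holds the possible outcomes S with more than r vertices,
    \<open>R S\<close> the vertices whose states are revealed, and \<open>N S\<close> the candidates
    for the vertex c that follows the last exit. \<open>D S\<close> is decided inside
    \<open>R S\<close>, \<open>B S c\<close> outside it.\<close>
  define F where "F = {S\<in>Pow (hop E x\<^sub>0 r). r < card S}"
  define R where "R S = S \<union> (\<Union>x\<in>S. nbrs E x)" for S
  define N where "N S = (\<Union>a\<in>R S. nbrs E a)" for S
  define D where "D S = {\<omega>\<in>space Om. hop (weak_edges V \<omega>) x\<^sub>0 r = S}" for S
  define B where "B S c = {\<omega>\<in>space Om. reaches_far E (V - R S) c n \<omega>}" for S c
  have "finite F" by (simp add: F_def finite_hop_E)
  have S: "S \<subseteq> V" "finite S" "S \<subseteq> hop E x\<^sub>0 r" if "S \<in> F" for S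
    using that hop_E_sub[OF x0, of r] finite_subset[OF _ finite_hop_E] by (auto simp: F_def)
  have RV: "R S \<subseteq> V" and finite_R: "finite (R S)" if "S \<in> F" for S
    using S[OF that] nbrs_sub finite_nbrs by (auto simp: R_def)
  have NV: "N S \<subseteq> V" and finite_N: "finite (N S)" if "S \<in> F" for S
    using finite_R[OF that] nbrs_sub finite_nbrs by (auto simp: N_def)
  \<comment> \<open>Source of the constant: passing from S to \<open>R S\<close> multiplies the size
    by at most d + 1, and passing on to \<open>N S\<close> by at most d.\<close>
  have card_N: "card (N S) \<le> d * (d + 1) * card S" if "S \<in> F" for S
  proof -
    have "card (\<Union>x\<in>S. nbrs E x) \<le> (\<Sum>x\<in>S. card (nbrs E x))"
      using S[OF that] by (intro card_UN_le)
    also have "\<dots> = card S * d" using S(1)[OF that] card_nbrs by (simp add: subset_eq)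
    finally have "card (R S) \<le> (d + 1) * card S"
      unfolding R_def using card_Un_le[of S "\<Union>x\<in>S. nbrs E x"] by (simp add: algebra_simps)
    then have "card (R S) * d \<le> (d + 1) * card S * d" by (rule mult_le_mono1)
    moreover have "card (N S) \<le> (\<Sum>a\<in>R S. card (nbrs E a))"
      unfolding N_def using finite_R[OF that] by (intro card_UN_le)
    moreover have "\<dots> = card (R S) * d" using RV[OF that] card_nbrs by (simp add: subset_eq)
    ultimately show ?thesis by (simp add: algebra_simps)
  qed
  have cover: "\<exists>S\<in>F. \<exists>c\<in>N S. \<omega> \<in> D S \<inter> B S c"
    if \<omega>: "\<omega> \<in> space Om" and far: "reaches_far E V x\<^sub>0 (n + r + 2) \<omega>" for \<omega>
  proof -
    define S where "S = hop (weak_edges V \<omega>) x\<^sub>0 r"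
    obtain x where x: "weakly_connected V \<omega> x\<^sub>0 x" "\<And>k. k < n + r + 2 \<Longrightarrow> x \<notin> hop E x\<^sub>0 k"
      using far unfolding reaches_far_def by blast
    have S_sub: "S \<subseteq> hop E x\<^sub>0 r" unfolding S_def by (rule hop_weak_sub[OF \<omega>])
    \<comment> \<open>Since x is reachable but unexplored, the exploration is not closed and must
      have more than r vertices.\<close>
    have "x \<notin> S" using S_sub x(2)[of r] by auto
    then have "r < card S"
      using hop_card_or_closed[of "weak_edges V \<omega>" x\<^sub>0 r] x(1)
        finite_subset[OF hop_weak_sub[OF \<omega>] finite_hop_E]
      unfolding S_def weakly_connected_iff_hop by blast
    with S_sub have "S \<in> F" by (simp add: F_def)
    have R_sub: "R S \<subseteq> hop E x\<^sub>0 (Suc r)"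
      using S_sub by (auto simp: R_def nbrs_def)
    have "x\<^sub>0 \<in> R S" by (simp add: R_def S_def self_in_hop)
    moreover have "x \<notin> R S" using R_sub x(2)[of "Suc r"] by auto
    \<comment> \<open>The path starts in \<open>R S\<close>, which rules out the first alternative
      of \<open>last_exit\<close>.\<close>
    ultimately obtain a c where a: "a \<in> R S" and ac: "(a, c) \<in> weak_edges V \<omega>"
      and c: "(c, x) \<in> (weak_edges (V - R S) \<omega>)\<^sup>*"
      using last_exit[of x\<^sub>0 x V \<omega> "R S"] x(1)
      unfolding weakly_connected_def weak_edges_def[symmetric] by blast
    have E: "(a, c) \<in> E" using ac weak_edges_sub_E'[OF \<omega>] by blast
    \<comment> \<open>The radii add up: S lies within distance r of \<open>x\<^sub>0\<close>,
      \<open>R S\<close> within r + 1 and c within r + 2. A vertex at distance at least n + r + 2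
      from \<open>x\<^sub>0\<close> is then at distance at least n from c.\<close>
    then have "c \<in> hop E x\<^sub>0 (r + 2)" using a R_sub by auto
    then have "x \<notin> hop E c k" if "k < n" for k
      using that x(2)[of "r + 2 + k"] hop_trans[of c E x\<^sub>0 "r + 2" x k] by auto
    with c have "reaches_far E (V - R S) c n \<omega>"
      unfolding reaches_far_def weakly_connected_def weak_edges_def[symmetric] by blast
    then have "\<omega> \<in> D S \<inter> B S c" using \<omega> by (simp add: D_def B_def S_def)
    moreover have "c \<in> N S" using a E by (auto simp: N_def nbrs_def)
    ultimately show ?thesis using \<open>S \<in> F\<close> by blast
  qed
  have sets_D: "D S \<in> sets Om" for S
    unfolding D_def by (rule sets_hop_eq[OF order_refl x0])
  have sets_B: "B S c \<in> sets Om" if "S \<in> F" "c \<in> N S" for S c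
    unfolding B_def using that NV by (intro sets_reaches_far) auto
  have DB: "emeasure Om (D S \<inter> B S c) \<le> emeasure Om (D S) * far_prob x\<^sub>0 n"
    if "S \<in> F" "c \<in> N S" for S c
  proof -
    have local: "hop (weak_edges V \<omega>) x\<^sub>0 r = S \<longleftrightarrow> hop (weak_edges (R S) \<omega>) x\<^sub>0 r = S"
      if "\<omega> \<in> space Om" for \<omega>
      using weak_edges_sub_E'[OF that] RV[OF \<open>S \<in> F\<close>]
      by (intro hop_weak_edges_local) (auto simp: R_def nbrs_def)
    let ?P = "\<lambda>\<omega>. hop (weak_edges (R S) \<omega>) x\<^sub>0 r = S"
    let ?Q = "reaches_far E (V - R S) c n"
    have "c \<in> V" using that NV by auto
    have "D S = {\<omega>\<in>space Om. ?P (restrict \<omega> (R S))}"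
      using local by (auto simp: D_def weak_edges_restrict)
    moreover have "B S c = {\<omega>\<in>space Om. ?Q (restrict \<omega> (V - R S))}"
      by (simp add: B_def reaches_far_restrict)
    moreover have "D S \<inter> B S c =
        {\<omega>\<in>space Om. ?P (restrict \<omega> (R S)) \<and> ?Q (restrict \<omega> (V - R S))}"
      using calculation by auto
    moreover have "Measurable.pred (PiM (R S) law) ?P" "Measurable.pred (PiM (V - R S) law) ?Q"
      using RV[OF that(1)] x0 \<open>c \<in> V\<close> by (simp_all add: measurable_hop_eq measurable_reaches_far)
    then have "emeasure Om {\<omega>\<in>space Om. ?P (restrict \<omega> (R S)) \<and> ?Q (restrict \<omega> (V - R S))} =
        emeasure Om {\<omega>\<in>space Om. ?P (restrict \<omega> (R S))} *
        emeasure Om {\<omega>\<in>space Om. ?Q (restrict \<omega> (V - R S))}"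
      using RV[OF that(1)] by (intro emeasure_indep) auto
    ultimately have "emeasure Om (D S \<inter> B S c) = emeasure Om (D S) * emeasure Om (B S c)"
      by (simp only:)
    \<comment> \<open>Allowing the states in \<open>R S\<close> as well only enlarges the event;
      transitivity then moves the centre from c to \<open>x\<^sub>0\<close>.\<close>
    moreover have "emeasure Om (B S c) \<le> far_prob c n"
      unfolding B_def far_prob_def using \<open>c \<in> V\<close>
      by (intro emeasure_mono sets_reaches_far) (auto intro: reaches_far_mono[of "V - R S" V])
    ultimately show ?thesis
      using far_prob_le[OF \<open>c \<in> V\<close> x0, of n] by (auto intro: mult_left_mono order_trans)
  qed
  \<comment> \<open>Union bound over the finitely many pairs (S, c).\<close>
  have "far_prob x\<^sub>0 (n + r + 2) \<le> emeasure Om (\<Union>(S, c)\<in>Sigma F N. D S \<inter> B S c)"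
    unfolding far_prob_def
  proof (rule emeasure_mono)
    show "{\<omega>\<in>space Om. reaches_far E V x\<^sub>0 (n + r + 2) \<omega>} \<subseteq> (\<Union>(S, c)\<in>Sigma F N. D S \<inter> B S c)"
    proof
      fix \<omega> assume "\<omega> \<in> {\<omega>\<in>space Om. reaches_far E V x\<^sub>0 (n + r + 2) \<omega>}"
      then obtain S c where "S \<in> F" "c \<in> N S" "\<omega> \<in> D S \<inter> B S c" using cover by blast
      then show "\<omega> \<in> (\<Union>(S, c)\<in>Sigma F N. D S \<inter> B S c)" by (intro UN_I[of "(S, c)"]) simp_all
    qed
    show "(\<Union>(S, c)\<in>Sigma F N. D S \<inter> B S c) \<in> sets Om"
      using sets_D sets_B \<open>finite F\<close> finite_N by (intro sets.finite_UN) auto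
  qed
  also have "\<dots> \<le> (\<Sum>(S, c)\<in>Sigma F N. emeasure Om (D S \<inter> B S c))"
    unfolding split_beta using sets_D sets_B \<open>finite F\<close> finite_N
    by (intro emeasure_subadditive_finite) auto
  also have "\<dots> = (\<Sum>S\<in>F. \<Sum>c\<in>N S. emeasure Om (D S \<inter> B S c))"
    using \<open>finite F\<close> finite_N by (simp add: sum.Sigma)
  also have "\<dots> \<le> (\<Sum>S\<in>F. \<Sum>c\<in>N S. emeasure Om (D S) * far_prob x\<^sub>0 n)"
    using DB by (intro sum_mono)
  also have "\<dots> = (\<Sum>S\<in>F. of_nat (card (N S)) * (emeasure Om (D S) * far_prob x\<^sub>0 n))"
    by simp
  also have "\<dots> \<le> (\<Sum>S\<in>F. of_nat (d * (d + 1) * card S) * (emeasure Om (D S) * far_prob x\<^sub>0 n))"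
    using card_N by (intro sum_mono mult_right_mono) (simp_all only: of_nat_le_iff zero_le)
  also have "\<dots> = of_nat (d * (d + 1)) * (\<Sum>S\<in>F. of_nat (card S) * emeasure Om (D S)) * far_prob x\<^sub>0 n"
    by (simp add: sum_distrib_left sum_distrib_right mult_ac)
  also have "(\<Sum>S\<in>F. of_nat (card S) * emeasure Om (D S)) = (\<integral>\<^sup>+\<omega>. hop_tail x\<^sub>0 r \<omega> \<partial>Om)"
    unfolding F_def D_def by (rule nn_integral_hop_tail[OF x0, symmetric])
  finally show ?thesis .
qed

section \<open>The cluster size and the vanishing tail expectation\<close>

lemma weak_cluster_eq_UN_hop:
  assumes "\<omega> \<in> space Om" "x \<in> V"
  shows "weak_cluster V \<omega> x = (\<Union>k. hop (weak_edges V \<omega>) x k)"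
  using hop_weak_sub[OF assms(1), of x] hop_E_sub[OF assms(2)]
  unfolding weak_cluster_def weakly_connected_iff_hop by blast

text \<open>Continuity from below along the increasing balls. The supremum makes the cluster size
  measurable and bounds \<open>hop_tail\<close> for all r at once.\<close>

lemma cluster_size_eq_SUP:
  assumes "\<omega> \<in> space Om" "x \<in> V"
  shows "emeasure (count_space UNIV) (weak_cluster V \<omega> x) =
    (SUP k. of_nat (card (hop (weak_edges V \<omega>) x k)))"
proof -
  have "incseq (hop (weak_edges V \<omega>) x)" by (auto simp: incseq_def dest: hop_mono)
  then have "emeasure (count_space UNIV) (weak_cluster V \<omega> x) =
      (SUP k. emeasure (count_space UNIV) (hop (weak_edges V \<omega>) x k))"
    unfolding weak_cluster_eq_UN_hop[OF assms] by (intro SUP_emeasure_incseq[symmetric]) auto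
  then show ?thesis
    using finite_subset[OF hop_weak_sub[OF assms(1)] finite_hop_E]
    by (simp add: emeasure_count_space_finite)
qed

text \<open>The ball is a random element of the finite set of subsets of a graph ball, where every
  function is measurable.\<close>

lemma measurable_card_hop:
  assumes "x \<in> V"
  shows "(\<lambda>\<omega>. card (hop (weak_edges V \<omega>) x k)) \<in> measurable Om (count_space UNIV)"
proof -
  note m = measurable_hop_eq[OF order_refl assms, of k, folded config_measure_def]
  have "(\<lambda>\<omega>. hop (weak_edges V \<omega>) x k) \<in> measurable Om (count_space (Pow (hop E x k)))"
    using hop_weak_sub m finite_hop_E
    by (subst measurable_count_space_eq2) (auto simp: vimage_def pred_def Int_def conj_commute)
  then show ?thesis by (rule measurable_compose) simp
qed

text \<open>Dominated convergence, with the integrable cluster size as the bound. Integrability also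
  makes the cluster almost surely finite, and once r exceeds its size the condition r < |D|
  fails.\<close>

lemma hop_tail_integral_tendsto_0:
  assumes x: "x \<in> V" and fin: "mean_cluster_size V E x d p < \<infinity>"
  shows "(\<lambda>r. \<integral>\<^sup>+\<omega>. hop_tail x r \<omega> \<partial>Om) \<longlonglongrightarrow> 0"
proof -
  note measurable_card_hop[OF x, measurable]
  let ?w = "\<lambda>\<omega>. emeasure (count_space UNIV) (weak_cluster V \<omega> x)"
  have "(\<lambda>\<omega>. SUP k. of_nat (card (hop (weak_edges V \<omega>) x k)) :: ennreal) \<in> borel_measurable Om"
    by measurable
  then have w: "?w \<in> borel_measurable Om"
    by (subst measurable_cong[OF cluster_size_eq_SUP[OF _ x]])
  have le: "hop_tail x r \<omega> \<le> ?w \<omega>" if "\<omega> \<in> space Om" for r \<omega>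
    unfolding cluster_size_eq_SUP[OF that x] hop_tail_def Let_def
    by (auto intro: SUP_upper)
  have "AE \<omega> in Om. ?w \<omega> \<noteq> \<infinity>"
    using fin w unfolding mean_cluster_size_def by (intro nn_integral_PInf_AE) auto
  then have lim: "AE \<omega> in Om. (\<lambda>r. hop_tail x r \<omega>) \<longlonglongrightarrow> 0"
  proof (rule AE_mp[OF _ AE_I2], intro impI)
    fix \<omega> assume \<omega>: "\<omega> \<in> space Om" and "?w \<omega> \<noteq> \<infinity>"
    then obtain m where m: "?w \<omega> < of_nat m" using ennreal_Ex_less_of_nat by (auto simp: less_top)
    have "hop_tail x r \<omega> = 0" if "m \<le> r" for r
    proof -
      have "(of_nat (card (hop (weak_edges V \<omega>) x r)) :: ennreal) \<le> ?w \<omega>"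
        unfolding cluster_size_eq_SUP[OF \<omega> x] by (rule SUP_upper) simp
      with m have "card (hop (weak_edges V \<omega>) x r) < m"
        by (metis le_less_trans of_nat_less_iff)
      with that show ?thesis by (simp add: hop_tail_def Let_def)
    qed
    then show "(\<lambda>r. hop_tail x r \<omega>) \<longlonglongrightarrow> 0"
      by (intro tendsto_eventually) (auto simp: eventually_sequentially)
  qed
  have "(\<lambda>r. \<integral>\<^sup>+\<omega>. hop_tail x r \<omega> \<partial>Om) \<longlonglongrightarrow> (\<integral>\<^sup>+\<omega>. 0 \<partial>Om)"
  proof (rule nn_integral_dominated_convergence[where w = ?w])
    show "hop_tail x r \<in> borel_measurable Om" for r
      unfolding hop_tail_def[abs_def] Let_def by measurable
    show "(\<integral>\<^sup>+\<omega>. ?w \<omega> \<partial>Om) < \<infinity>" using fin by (simp add: mean_cluster_size_def)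
  qed (use w le lim in auto)
  then show ?thesis by simp
qed

section \<open>Iteration of the recursive inequality\<close>

lemma far_prob_decay:
  assumes x: "x \<in> V" and fin: "mean_cluster_size V E x d p < \<infinity>"
  shows "\<exists>s>0. \<forall>k. far_prob x (k * s) \<le> ennreal ((1 / 2) ^ k)"
proof -
  have "(\<lambda>r. of_nat (d * (d + 1)) * (\<integral>\<^sup>+\<omega>. hop_tail x r \<omega> \<partial>Om)) \<longlonglongrightarrow> of_nat (d * (d + 1)) * 0"
    by (intro ennreal_tendsto_cmult hop_tail_integral_tendsto_0 assms)
      (simp add: ennreal_of_nat_eq_real_of_nat)
  then have "\<forall>\<^sub>F r in sequentially. of_nat (d * (d + 1)) * (\<integral>\<^sup>+\<omega>. hop_tail x r \<omega> \<partial>Om) < ennreal (1 / 2)"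
    using ennreal_lessI[of "1 / 2" 0] by (intro order_tendstoD) simp_all
  then obtain r where r: "of_nat (d * (d + 1)) * (\<integral>\<^sup>+\<omega>. hop_tail x r \<omega> \<partial>Om) < ennreal (1 / 2)"
    by (auto simp: eventually_sequentially)
  \<comment> \<open>With this r, each application of \<open>far_prob_step\<close> gains r + 2 in
    distance at the cost of a factor 1/2.\<close>
  have "far_prob x (k * (r + 2)) \<le> ennreal ((1 / 2) ^ k)" for k
  proof (induction k)
    case 0
    show ?case using far_prob_le_1 by simp
  next
    case (Suc k)
    have "far_prob x (Suc k * (r + 2)) = far_prob x (k * (r + 2) + r + 2)"
      by (simp add: algebra_simps)
    also have "\<dots> \<le> of_nat (d * (d + 1)) * (\<integral>\<^sup>+\<omega>. hop_tail x r \<omega> \<partial>Om) * far_prob x (k * (r + 2))"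
      by (rule far_prob_step[OF x])
    also have "\<dots> \<le> ennreal (1 / 2) * ennreal ((1 / 2) ^ k)"
      using r Suc.IH by (intro mult_mono) auto
    also have "\<dots> = ennreal ((1 / 2) ^ Suc k)"
      by (subst ennreal_mult[symmetric]) simp_all
    finally show ?case .
  qed
  then show ?thesis by (intro exI[of _ "r + 2"]) simp
qed

lemma reaches_sphere_decay:
  assumes x: "x \<in> V" and fin: "mean_cluster_size V E x d p < \<infinity>"
  shows "\<exists>\<alpha>>0. \<forall>n. measure Om {\<omega>\<in>space Om. reaches_sphere V E x n \<omega>} \<le> 2 * exp (- (real n * \<alpha>))"
proof -
  obtain s where s: "s > 0" "\<And>k. far_prob x (k * s) \<le> ennreal ((1 / 2) ^ k)"
    using far_prob_decay[OF assms] by blast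
  \<comment> \<open>Chosen so that n steps give the factor 2 to the power -n/s. Rounding n/s down to
    \<open>n div s\<close> loses at most one halving, which is the constant 2 of the bound.\<close>
  let ?\<alpha> = "ln 2 / real s"
  have "measure Om {\<omega>\<in>space Om. reaches_sphere V E x n \<omega>} \<le> 2 * exp (- (real n * ?\<alpha>))" for n
  proof -
    let ?k = "n div s"
    have "emeasure Om {\<omega>\<in>space Om. reaches_sphere V E x n \<omega>} \<le> far_prob x n"
      unfolding far_prob_def using reaches_sphere_imp_far
      by (intro emeasure_mono sets_reaches_far x) auto
    also have "\<dots> \<le> far_prob x (?k * s)" by (intro far_prob_antimono x) simp
    also have "\<dots> \<le> ennreal ((1 / 2) ^ ?k)" by (rule s(2))
    finally have "measure Om {\<omega>\<in>space Om. reaches_sphere V E x n \<omega>} \<le> (1 / 2) ^ ?k"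
      by (simp add: Om.emeasure_eq_measure)
    also have "\<dots> = exp (- (real ?k * ln 2))"
      by (simp add: exp_minus exp_of_nat_mult power_one_over inverse_eq_divide)
    also have "\<dots> \<le> exp (ln 2 - real n * ?\<alpha>)"
    proof -
      have "n \<le> (?k + 1) * s" using s(1) dividend_less_div_times[of s n] by (simp add: mult.commute)
      then have "real n \<le> (real ?k + 1) * real s"
        by (metis of_nat_1 of_nat_add of_nat_le_iff of_nat_mult)
      then have "real n / real s \<le> real ?k + 1" using s(1) by (simp add: divide_le_eq)
      then have "real n / real s * ln 2 \<le> (real ?k + 1) * ln 2" by (rule mult_right_mono) simp
      then show ?thesis by (simp add: algebra_simps)
    qed
    also have "\<dots> = 2 * exp (- (real n * ?\<alpha>))" by (simp add: exp_diff exp_minus field_simps)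
    finally show ?thesis .
  qed
  then show ?thesis using s(1) by (intro exI[of _ ?\<alpha>]) simp
qed

end

theorem theorem19:
  fixes V :: "'a set" and E :: "('a \<times> 'a) set" and orig :: 'a
    and d :: nat and p :: "nat \<Rightarrow> real"
  assumes "simple_symmetric_digraph V E"
    and "orig \<in> V"
    and "regular_digraph V E d"
    and "connected_digraph V E"
    and "vertex_transitive V E"
    and "prob_vector d p"
    and "mean_cluster_size V E orig d p < \<infinity>"
  shows "\<exists>\<alpha>>0. \<forall>\<^sub>F n in sequentially.
    measure (config_measure V E d p)
      {\<omega> \<in> space (config_measure V E d p). reaches_sphere V E orig n \<omega>}
      \<le> 2 * exp (- (real n * \<alpha>))"
proof -
  interpret percolation V E d p
    using assms by unfold_locales
  show ?thesis
    using reaches_sphere_decay[OF assms(2,7)] always_eventually by blast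
qed

end
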